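(* The following hold. (i) Let $f\in \mathrm{H}^+(\mathbb{R})$ be reversible in $\mathrm{H}(\mathbb{R})$. Then $f$ is strongly reversible in $\mathrm{H}(\mathbb{R})$ if and only if there is an $h\in\mathrm{H}^-(\mathbb{R})$ with $hfh^{-1}=f^{-1}$. (ii) An element of $\mathrm{PLF}(\mathbb{R})$ is reversible in $\mathrm{PLF}(\mathbb{R})$ if and only if it is strongly reversible in $\mathrm{PLF}(\mathbb{R})$. (iii) Let $f\in \mathrm{PL}^+(\mathbb{R})$ be reversible in $\mathrm{PL}(\mathbb{R})$. Then $f$ is strongly reversible in $\mathrm{PL}(\mathbb{R})$ if and only if there is an $h\in\mathrm{PL}^-(\mathbb{R})$ with $hfh^{-1}=f^{-1}$.
   Context: $\mathrm{H}(\mathbb{R})$ is the group (under composition) of all homeomorphisms of $\mathbb{R}$. $\mathrm{PLF}(\mathbb{R})$ is the subgroup of piecewise linear homeomorphisms of $\mathbb{R}$ that are locally affine at all but a finite number of points of $\mathbb{R}$. $\mathrm{PL}(\mathbb{R})$ is the subgroup of piecewise linear homeomorphisms of $\mathbb{R}$ that are locally affine at all but a discrete set of points of $\mathbb{R}$. A superscript $+$ denotes the index-$2$ subgroup of orientation preserving (strictly increasing) elements, and a superscript $-$ denotes the coset of orientation reversing (strictly decreasing) elements. Let $G$ be a group. An element $g\in G$ is reversible in $G$ if there is $h\in G$ with $hgh^{-1}=g^{-1}$. An involution in $G$ is an element whose square is the identity (so the identity counts as an involution). An element $g\in G$ is strongly reversible in $G$ if there is an involution $\sigma\in G$ with $\sigma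 g\sigma^{-1}=g^{-1}$. *)

theory Defs
  imports "HOL-Analysis.Analysis" "HOL-Algebra.Group"
begin

definition reversible :: "('a, 'b) monoid_scheme \<Rightarrow> 'a \<Rightarrow> bool" where
  "reversible G g \<longleftrightarrow>
     g \<in> carrier G \<and> (\<exists>h\<in>carrier G. h \<otimes>\<^bsub>G\<^esub> g \<otimes>\<^bsub>G\<^esub> inv\<^bsub>G\<^esub> h = inv\<^bsub>G\<^esub> g)"

definition involution :: "('a, 'b) monoid_scheme \<Rightarrow> 'a \<Rightarrow> bool" where
  "involution G s \<longleftrightarrow> s \<in> carrier G \<and> s \<otimes>\<^bsub>G\<^esub> s = \<one>\<^bsub>G\<^esub>"

definition strongly_reversible :: "('a, 'b) monoid_scheme \<Rightarrow> 'a \<Rightarrow> bool" where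
  "strongly_reversible G g \<longleftrightarrow>
     g \<in> carrier G \<and> (\<exists>s. involution G s \<and> s \<otimes>\<^bsub>G\<^esub> g \<otimes>\<^bsub>G\<^esub> inv\<^bsub>G\<^esub> s = inv\<^bsub>G\<^esub> g)"

definition homeo_real :: "(real \<Rightarrow> real) monoid" where
  "homeo_real =
     \<lparr>carrier = {f. homeomorphic_map euclidean euclidean f}, monoid.mult = (\<circ>), one = id\<rparr>"

definition locally_affine_at :: "(real \<Rightarrow> real) \<Rightarrow> real \<Rightarrow> bool" where
  "locally_affine_at f x \<longleftrightarrow> (\<exists>a b. \<forall>\<^sub>F y in nhds x. f y = a * y + b)"

definition non_affine_points :: "(real \<Rightarrow> real) \<Rightarrow> real set" where
  "non_affine_points f = {x. \<not> locally_affine_at f x}"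

definition PLF_real :: "(real \<Rightarrow> real) monoid" where
  "PLF_real = homeo_real\<lparr>carrier := {f \<in> carrier homeo_real. finite (non_affine_points f)}\<rparr>"

text \<open>The set of points at which a function is not locally affine is always closed (see
  \<open>closed_non_affine_points\<close> below), so a discrete such set meets every bounded interval in
  a finite set.\<close>

definition PL_real :: "(real \<Rightarrow> real) monoid" where
  "PL_real = homeo_real\<lparr>carrier := {f \<in> carrier homeo_real. discrete (non_affine_points f)}\<rparr>"

definition orientation_preserving :: "(real \<Rightarrow> real) monoid \<Rightarrow> (real \<Rightarrow> real) set" where
  "orientation_preserving G = {f \<in> carrier G. strict_mono f}"

definition orientation_reversing :: "(real \<Rightarrow> real) monoid \<Rightarrow> (real \<Rightarrow> real) set" where
  "orientation_reversing G = {f \<in> carrier G. strict_antimono_on UNIV f}"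

lemma carrier_homeo_realI:
  assumes "homeomorphism UNIV UNIV f g"
  shows "f \<in> carrier homeo_real"
proof -
  have "homeomorphic_maps euclidean euclidean f g"
    using assms by (simp add: homeomorphic_maps_def homeomorphism_def)
  thus ?thesis by (auto simp: homeo_real_def homeomorphic_map_maps)
qed

lemma carrier_homeo_realE:
  assumes "f \<in> carrier homeo_real"
  obtains g where "homeomorphism UNIV UNIV f g" "homeomorphism UNIV UNIV g f"
proof -
  obtain g where "homeomorphic_maps euclidean euclidean f g"
    using assms by (auto simp: homeo_real_def homeomorphic_map_maps)
  hence "homeomorphism UNIV UNIV f g"
    by (auto simp: homeomorphic_maps_def homeomorphism_def) (metis rangeI)+
  thus ?thesis using that homeomorphism_sym by blast
qed

lemma group_homeo_real: "group homeo_real"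
proof (rule groupI)
  fix f assume "f \<in> carrier homeo_real"
  then obtain g where g: "homeomorphism UNIV UNIV f g" "homeomorphism UNIV UNIV g f"
    by (rule carrier_homeo_realE)
  have "g \<otimes>\<^bsub>homeo_real\<^esub> f = \<one>\<^bsub>homeo_real\<^esub>"
    using g(1) by (auto simp: homeo_real_def homeomorphism_def)
  thus "\<exists>g\<in>carrier homeo_real. g \<otimes>\<^bsub>homeo_real\<^esub> f = \<one>\<^bsub>homeo_real\<^esub>"
    using carrier_homeo_realI[OF g(2)] by blast
qed (auto simp: homeo_real_def comp_assoc intro: homeomorphic_map_compose)

lemma inv_homeo_real:
  assumes "f \<in> carrier homeo_real"
  shows "inv\<^bsub>homeo_real\<^esub> f = inv_into UNIV f"
proof -
  interpret group homeo_real by (rule group_homeo_real)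
  from assms obtain g where g: "homeomorphism UNIV UNIV f g" "homeomorphism UNIV UNIV g f"
    by (rule carrier_homeo_realE)
  have gf: "g \<circ> f = id" "f \<circ> g = id" using g by (auto simp: homeomorphism_def)
  have "inv\<^bsub>homeo_real\<^esub> f = g"
    using assms carrier_homeo_realI[OF g(2)] gf
    by (intro inv_equality) (auto simp: homeo_real_def)
  also have "g = inv_into UNIV f"
    using gf by (metis inv_unique_comp)
  finally show ?thesis .
qed

lemma open_locally_affine: "open {x. locally_affine_at f x}"
  unfolding open_contains_ball
proof (clarify)
  fix x assume "locally_affine_at f x"
  then obtain a b S where S: "open S" "x \<in> S" "\<forall>y\<in>S. f y = a * y + b"
    by (auto simp: locally_affine_at_def eventually_nhds)
  hence "S \<subseteq> {x. locally_affine_at f x}"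
    by (auto simp: locally_affine_at_def eventually_nhds)
  thus "\<exists>e>0. ball x e \<subseteq> {x. locally_affine_at f x}"
    using S openE by (meson subset_trans)
qed

lemma closed_non_affine_points: "closed (non_affine_points f)"
  using open_locally_affine[of f] by (simp add: closed_def non_affine_points_def Compl_eq)

lemma discrete_non_affine_points_iff:
  "discrete (non_affine_points f) \<longleftrightarrow> (\<forall>x. \<forall>\<^sub>F y in at x. y \<notin> non_affine_points f)"
proof -
  have "\<forall>\<^sub>F y in at x. y \<notin> non_affine_points f" if "x \<notin> non_affine_points f" for x
    using closed_non_affine_points[of f] that
    by (metis closed_limpt islimpt_iff_eventually)
  thus ?thesis by (auto simp: discrete_altdef)
qed

lemma isCont_eventually_nhds:
  assumes "isCont g x" "\<forall>\<^sub>F y in nhds (g x). P y"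
  shows "\<forall>\<^sub>F y in nhds x. P (g y)"
proof -
  have "filterlim g (nhds (g x)) (nhds x)"
    using assms(1) by (simp add: continuous_at tendsto_at_iff_tendsto_nhds)
  thus ?thesis using assms(2) by (simp add: filterlim_iff)
qed

lemma locally_affine_at_comp:
  assumes "isCont g x" "locally_affine_at g x" "locally_affine_at f (g x)"
  shows "locally_affine_at (f \<circ> g) x"
proof -
  obtain a b where ab: "\<forall>\<^sub>F y in nhds x. g y = a * y + b"
    using assms by (auto simp: locally_affine_at_def)
  obtain c d where "\<forall>\<^sub>F y in nhds (g x). f y = c * y + d"
    using assms by (auto simp: locally_affine_at_def)
  hence cd: "\<forall>\<^sub>F y in nhds x. f (g y) = c * g y + d"
    using assms(1) by (rule isCont_eventually_nhds[rotated])
  have "\<forall>\<^sub>F y in nhds x. (f \<circ> g) y = (c * a) * y + (c * b + d)"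
    using ab cd by eventually_elim (simp add: algebra_simps)
  thus ?thesis unfolding locally_affine_at_def by blast
qed

lemma locally_affine_at_inverse:
  assumes "homeomorphism UNIV UNIV f g" "locally_affine_at f (g x)"
  shows "locally_affine_at g x"
proof -
  have gf: "\<And>y. g (f y) = y" "\<And>y. f (g y) = y" and "continuous_on UNIV g"
    using assms by (auto simp: homeomorphism_def)
  hence cont: "isCont g x" by (simp add: continuous_on_eq_continuous_at)
  obtain a b where ab: "\<forall>\<^sub>F y in nhds (g x). f y = a * y + b"
    using assms by (auto simp: locally_affine_at_def)
  have "\<forall>\<^sub>F y in at (g x). f y = a * y + b \<and> y \<noteq> g x"
    using ab by (auto simp: eventually_at_filter elim: eventually_mono)
  then obtain y where "f y = a * y + b" "y \<noteq> g x"
    by (metis (mono_tags, lifting) eventually_happens trivial_limit_at)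
  moreover have "f (g x) = a * g x + b"
    using ab by (rule eventually_nhds_x_imp_x)
  ultimately have "a \<noteq> 0" using gf by (metis mult_zero_left)
  have "\<forall>\<^sub>F y in nhds x. f (g y) = a * g y + b"
    using ab cont by (rule isCont_eventually_nhds[rotated])
  hence "\<forall>\<^sub>F y in nhds x. g y = (1 / a) * y + (- b / a)"
    by eventually_elim (use \<open>a \<noteq> 0\<close> in \<open>simp add: gf field_simps\<close>)
  thus ?thesis unfolding locally_affine_at_def by blast
qed

lemma non_affine_points_comp:
  assumes "g \<in> carrier homeo_real"
  shows "non_affine_points (f \<circ> g) \<subseteq> non_affine_points g \<union> g -` non_affine_points f"
proof -
  have "isCont g x" for x
    using assms by (auto elim!: carrier_homeo_realE
        simp: homeomorphism_def continuous_on_eq_continuous_at)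
  thus ?thesis by (auto simp: non_affine_points_def intro: locally_affine_at_comp)
qed

lemma non_affine_points_inverse:
  assumes "homeomorphism UNIV UNIV f g"
  shows "non_affine_points g \<subseteq> g -` non_affine_points f"
  using locally_affine_at_inverse[OF assms] by (auto simp: non_affine_points_def)

lemma non_affine_points_id: "non_affine_points id = {}"
proof -
  have "locally_affine_at id x" for x
    unfolding locally_affine_at_def by (rule exI[of _ 1], rule exI[of _ 0]) simp
  thus ?thesis by (simp add: non_affine_points_def)
qed

lemma subgroup_homeo_realI:
  assumes mono: "\<And>A B. P A \<Longrightarrow> B \<subseteq> A \<Longrightarrow> closed B \<Longrightarrow> P B"
    and Un: "\<And>A B. P A \<Longrightarrow> P B \<Longrightarrow> P (A \<union> B)"
    and vim: "\<And>A g. P A \<Longrightarrow> g \<in> carrier homeo_real \<Longrightarrow> P (g -` A)"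
    and empty: "P {}"
  shows "subgroup {f \<in> carrier homeo_real. P (non_affine_points f)} homeo_real"
proof -
  interpret group homeo_real by (rule group_homeo_real)
  show ?thesis
  proof (rule subgroupI)
    have "id \<in> carrier homeo_real"
      using one_closed by (simp add: homeo_real_def)
    hence "id \<in> {f \<in> carrier homeo_real. P (non_affine_points f)}"
      by (simp add: empty non_affine_points_id)
    thus "{f \<in> carrier homeo_real. P (non_affine_points f)} \<noteq> {}" by blast
  next
    fix f assume f: "f \<in> {f \<in> carrier homeo_real. P (non_affine_points f)}"
    then obtain g where g: "homeomorphism UNIV UNIV f g" "homeomorphism UNIV UNIV g f"
      by (auto elim: carrier_homeo_realE)
    have "inv\<^bsub>homeo_real\<^esub> f = g"
      using f carrier_homeo_realI[OF g(2)] g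
      by (intro inv_equality) (auto simp: homeo_real_def homeomorphism_def)
    thus "inv\<^bsub>homeo_real\<^esub> f \<in> {f \<in> carrier homeo_real. P (non_affine_points f)}"
      using f carrier_homeo_realI[OF g(2)] non_affine_points_inverse[OF g(1)]
      by (auto intro: mono vim closed_non_affine_points)
  next
    fix f g assume fg: "f \<in> {f \<in> carrier homeo_real. P (non_affine_points f)}"
      "g \<in> {f \<in> carrier homeo_real. P (non_affine_points f)}"
    have "f \<otimes>\<^bsub>homeo_real\<^esub> g = f \<circ> g" by (simp add: homeo_real_def)
    moreover have "P (non_affine_points (f \<circ> g))"
      using fg by (intro mono[OF Un[OF _ vim] non_affine_points_comp closed_non_affine_points]) auto
    ultimately show "f \<otimes>\<^bsub>homeo_real\<^esub> g \<in> {f \<in> carrier homeo_real. P (non_affine_points f)}"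
      using fg m_closed[of f g] by auto
  qed auto
qed

lemma subgroup_PLF_real: "subgroup (carrier PLF_real) homeo_real"
proof -
  have "finite (g -` A)" if "finite A" "g \<in> carrier homeo_real" for A g
    using that by (intro finite_vimageI) (auto simp: homeo_real_def dest: homeomorphic_imp_injective_map)
  thus ?thesis unfolding PLF_real_def
    by (simp, intro subgroup_homeo_realI) (auto intro: finite_subset)
qed

lemma subgroup_PL_real: "subgroup (carrier PL_real) homeo_real"
proof -
  have vim: "\<forall>x. \<forall>\<^sub>F y in at x. y \<notin> g -` A"
    if A: "\<forall>x. \<forall>\<^sub>F y in at x. y \<notin> A" and g: "g \<in> carrier homeo_real" for A g
  proof
    fix x
    have "inj g"
      using g by (auto simp: homeo_real_def dest: homeomorphic_imp_injective_map)
    hence "\<forall>\<^sub>F y in at x. g y \<noteq> g x"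
      by (auto simp: eventually_at_filter inj_eq)
    moreover have "(g \<longlongrightarrow> g x) (at x)"
      using g by (auto elim!: carrier_homeo_realE
          simp: homeomorphism_def continuous_on_def)
    ultimately have "filterlim g (at (g x)) (at x)"
      by (simp add: filterlim_at)
    thus "\<forall>\<^sub>F y in at x. y \<notin> g -` A"
      using A by (auto simp: filterlim_iff)
  qed
  show ?thesis unfolding PL_real_def discrete_non_affine_points_iff
    apply (simp, rule subgroup_homeo_realI[where P = "\<lambda>A. \<forall>x. \<forall>\<^sub>F y in at x. y \<notin> A"])
    subgoal by (meson eventually_mono subsetD)
    subgoal by (simp add: eventually_conj)
    subgoal using vim by blast
    subgoal by simp
    done
qed

lemma group_PLF_real: "group PLF_real"
  using group.subgroup_imp_group[OF group_homeo_real subgroup_PLF_real]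
  by (simp add: PLF_real_def)

lemma group_PL_real: "group PL_real"
  using group.subgroup_imp_group[OF group_homeo_real subgroup_PL_real]
  by (simp add: PL_real_def)

end

theory Submission
  imports Defs
begin

text \<open>
  If \<open>f\<close> preserves orientation and \<open>h\<close> is orientation reversing with \<open>f h f = h\<close>, then \<open>h\<^sup>2\<close>
  commutes with \<open>f\<close>, so that on its fixed point set \<open>F\<close>, which is invariant under \<open>f\<close>
  and \<open>h\<close>, the maps \<open>h\<close> and \<open>h\<^sup>-\<^sup>1\<close> agree. If a set \<open>U\<close> is, off \<open>F\<close>, invariant under \<open>f\<close>
  and exchanged with its complement by \<open>h\<close>, and if its boundary lies in \<open>F\<close>, then gluing \<open>h\<close> on
  \<open>U\<close> and \<open>h\<^sup>-\<^sup>1\<close> off \<open>U\<close> gives a decreasing involution that reverses \<open>f\<close>. Such a \<open>U\<close>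
  is obtained from the fixed points \<open>p\<close> of \<open>h\<close> and \<open>q\<close> of \<open>f h\<close>: it is the union of the intervals
  from \<open>f\<^sup>n p\<close> to \<open>f\<^sup>n q\<close> and of the set of all points beyond the orbit of \<open>p\<close>. In the piecewise
  linear case either \<open>h\<^sup>2\<close> is not affine between any two successive points of the orbit, which
  then has to be unbounded, so that the breakpoints created by the gluing do not accumulate (and
  which is impossible with finitely many breakpoints), or \<open>h\<^sup>2\<close> is the identity on the
  hull of the orbit, and the ray \<open>[p, \<infinity>)\<close> serves as \<open>U\<close>.

  In \<open>PLF\<close> an increasing \<open>f\<close> reversed by an increasing \<open>h\<close> is the identity, as comparing slopes
  near the supremum (possibly infinite) of the set of points moved by \<open>f\<close> shows. A decreasing \<open>f\<close>
  that is reversed by \<open>h\<close> is also reversed by \<open>f h\<close>; one of \<open>h\<close> and \<open>f h\<close> is increasing and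
  reverses \<open>f\<^sup>2\<close>, so \<open>f\<^sup>2 = id\<close>.
\<close>

section \<open>Reversal as the equation \<open>f h f = h\<close> in a group\<close>

lemma (in group) conj_eq_inv_iff:
  assumes "f \<in> carrier G" "h \<in> carrier G"
  shows "h \<otimes> f \<otimes> inv h = inv f \<longleftrightarrow> f \<otimes> h \<otimes> f = h"
proof
  assume *: "h \<otimes> f \<otimes> inv h = inv f"
  have "h \<otimes> f = h \<otimes> f \<otimes> inv h \<otimes> h"
    using assms by (simp add: m_assoc)
  also have "\<dots> = inv f \<otimes> h"
    by (simp only: *)
  finally have "f \<otimes> (h \<otimes> f) = f \<otimes> (inv f \<otimes> h)"
    by simp
  also have "\<dots> = h"
    using assms by (simp add: m_assoc[symmetric])
  finally show "f \<otimes> h \<otimes> f = h"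
    using assms by (simp add: m_assoc)
next
  assume *: "f \<otimes> h \<otimes> f = h"
  have "h \<otimes> f \<otimes> inv h = inv f \<otimes> (f \<otimes> h \<otimes> f) \<otimes> inv h"
    using assms by (simp add: m_assoc[symmetric])
  also have "\<dots> = inv f"
    unfolding * using assms by (simp add: m_assoc)
  finally show "h \<otimes> f \<otimes> inv h = inv f" .
qed

lemma (in group) reversible_iff:
  assumes "f \<in> carrier G"
  shows "reversible G f \<longleftrightarrow> (\<exists>h\<in>carrier G. f \<otimes> h \<otimes> f = h)"
  using assms conj_eq_inv_iff by (auto simp: reversible_def)

lemma (in group) strongly_reversible_iff:
  assumes "f \<in> carrier G"
  shows "strongly_reversible G f \<longleftrightarrow> (\<exists>s\<in>carrier G. s \<otimes> s = \<one> \<and> f \<otimes> s \<otimes> f = s)"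
  using assms conj_eq_inv_iff by (auto simp: strongly_reversible_def involution_def)

section \<open>Homeomorphisms of the line as monotone surjections, and their affine pieces\<close>

lemma continuous_on_strict_mono_surj:
  fixes f :: "real \<Rightarrow> real"
  assumes "strict_mono f" "surj f"
  shows "continuous_on UNIV f"
  using assms by (intro continuous_onI_mono) (auto simp: strict_mono_less_eq)

lemma strict_antimono_on_UNIV_less_iff:
  fixes f :: "'a::linorder \<Rightarrow> 'b::linorder"
  assumes "strict_antimono_on UNIV f"
  shows "f x < f y \<longleftrightarrow> y < x"
  using assms by (metis UNIV_I less_asym linorder_less_linear monotone_onD)

lemma strict_antimono_on_UNIV_le_iff:
  fixes f :: "'a::linorder \<Rightarrow> 'b::linorder"
  assumes "strict_antimono_on UNIV f"
  shows "f x \<le> f y \<longleftrightarrow> y \<le> x"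
  using strict_antimono_on_UNIV_less_iff[OF assms] by (metis linorder_not_less)

lemma continuous_on_strict_antimono_surj:
  fixes f :: "real \<Rightarrow> real"
  assumes "strict_antimono_on UNIV f" "surj f"
  shows "continuous_on UNIV f"
proof -
  have "strict_mono (\<lambda>x. - f x)"
    using assms(1) by (simp add: monotone_on_def)
  moreover have "surj (\<lambda>x. - f x)"
    by (metis assms(2) minus_minus surj_def)
  ultimately have "continuous_on UNIV (\<lambda>x. - (- f x))"
    by (intro continuous_on_minus continuous_on_strict_mono_surj)
  thus ?thesis by simp
qed

lemma carrier_homeo_real_iff:
  "f \<in> carrier homeo_real \<longleftrightarrow> surj f \<and> (strict_mono f \<or> strict_antimono_on UNIV f)"
proof
  assume "f \<in> carrier homeo_real"
  then obtain g where g: "homeomorphism UNIV UNIV f g"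
    by (rule carrier_homeo_realE)
  hence "continuous_on UNIV f" "inj f" "surj f"
    by (auto simp: homeomorphism_def intro: inj_on_inverseI)
  moreover have "strict_mono f \<or> strict_antimono_on UNIV f"
    using injective_eq_monotone_map[of UNIV f] calculation by simp
  ultimately show "surj f \<and> (strict_mono f \<or> strict_antimono_on UNIV f)"
    by simp
next
  assume *: "surj f \<and> (strict_mono f \<or> strict_antimono_on UNIV f)"
  hence "continuous_on UNIV f"
    using continuous_on_strict_mono_surj continuous_on_strict_antimono_surj by blast
  moreover have "inj f"
    using * strict_mono_imp_inj_on strict_antimono_iff_antimono by blast
  ultimately obtain g where "homeomorphism UNIV UNIV f g"
    using * injective_into_1d_eq_homeomorphism[of UNIV f] by (auto simp: path_connected_UNIV)
  thus "f \<in> carrier homeo_real"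
    by (rule carrier_homeo_realI)
qed

lemma antimono_fixed_point:
  fixes h :: "real \<Rightarrow> real"
  assumes "strict_antimono_on UNIV h" "surj h"
  obtains p where "h p = p"
proof -
  have cont: "continuous_on A (\<lambda>x. h x - x)" for A
    using continuous_on_strict_antimono_surj[OF assms]
    by (intro continuous_intros) (auto intro: continuous_on_subset)
  \<comment> \<open>Since \<open>h\<close> is decreasing, the larger of \<open>0\<close> and
    \<open>h 0\<close> is mapped to or below itself and the smaller one to or above itself, so
    \<open>h x - x\<close> changes sign between them.\<close>
  define u v where "u = min 0 (h 0)" and "v = max 0 (h 0)"
  have uv: "u \<le> 0" "u \<le> h 0" "0 \<le> v" "h 0 \<le> v" "v = 0 \<or> v = h 0" "u = 0 \<or> u = h 0"
    unfolding u_def v_def by linarith+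
  have le: "h x \<le> h y \<longleftrightarrow> y \<le> x" for x y
    by (rule strict_antimono_on_UNIV_le_iff[OF assms(1)])
  have "h v \<le> v"
    using uv le[of v 0] by linarith
  moreover have "u \<le> h u"
    using uv le[of 0 u] by linarith
  ultimately obtain p where "h p - p = 0"
    using IVT2'[of "\<lambda>x. h x - x" v 0 u] cont[of "{u..v}"] uv by (metis diff_ge_0_iff_ge diff_le_0_iff_le order_trans)
  thus ?thesis using that by simp
qed

text \<open>Slope and intercept, read off from \<open>deriv g\<close>, are locally constant on
  \<open>A\<close> and hence constant by connectedness.\<close>

lemma affine_on_connected:
  assumes "open A" "connected A" "A \<inter> non_affine_points g = {}"
  obtains a b where "\<And>x. x \<in> A \<Longrightarrow> g x = a * x + b"
proof (cases "A = {}")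
  case False
  then obtain x0 where x0: "x0 \<in> A" by blast
  have loc: "\<exists>a b. \<forall>\<^sub>F y in nhds x. g y = a * y + b" if "x \<in> A" for x
    using that assms(3) by (auto simp: non_affine_points_def locally_affine_at_def)
  have ev: "\<forall>\<^sub>F y in nhds x. deriv g x = deriv g y \<and> g x - deriv g x * x = g y - deriv g x * y"
    if x: "x \<in> A" for x
  proof -
    obtain a b where ab: "\<forall>\<^sub>F y in nhds x. g y = a * y + b"
      using loc[OF x] by blast
    have d: "deriv g y = a" if "\<forall>\<^sub>F z in nhds y. g z = a * z + b" for y
    proof -
      have "((\<lambda>z. a * z + b) has_field_derivative a) (at y)"
        by (auto intro!: derivative_eq_intros)
      thus ?thesis
        by (intro DERIV_imp_deriv) (use that in \<open>simp add: DERIV_cong_ev[OF refl _ refl]\<close>)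
    qed
    have "\<forall>\<^sub>F y in nhds x. \<forall>\<^sub>F z in nhds y. g z = a * z + b"
      using ab by (simp add: eventually_eventually)
    thus ?thesis
      using ab
    proof eventually_elim
      case (elim y)
      thus ?case using d[of y] d[OF ab] eventually_nhds_x_imp_x[OF ab] by simp
    qed
  qed
  have deriv: "deriv g x = deriv g x0" if "x \<in> A" for x
    using assms(2) that x0
  proof (rule connected_local_const)
    show "\<forall>a\<in>A. \<forall>\<^sub>F b in at a within A. deriv g a = deriv g b"
      by (auto simp: eventually_at_filter intro: eventually_mono[OF ev])
  qed
  have "g x - deriv g x0 * x = g x0 - deriv g x0 * x0" if "x \<in> A" for x
    using assms(2) that x0
  proof (rule connected_local_const)
    show "\<forall>a\<in>A. \<forall>\<^sub>F b in at a within A. g a - deriv g x0 * a = g b - deriv g x0 * b"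
      by (auto simp: eventually_at_filter deriv intro!: eventually_mono[OF ev])
  qed
  hence "g x = deriv g x0 * x + (g x0 - deriv g x0 * x0)" if "x \<in> A" for x
    using that by (metis add.commute diff_add_cancel)
  thus ?thesis using that by blast
qed (use that in auto)

lemma closed_if_finite_Int_atLeastAtMost:
  fixes B :: "real set"
  assumes "\<And>u v. finite (B \<inter> {u..v})"
  shows "closed B"
proof -
  have "\<not> x islimpt B" for x
  proof
    assume "x islimpt B"
    hence "infinite (B \<inter> cball x 1)"
      by (metis islimpt_eq_infinite_cball zero_less_one)
    thus False
      using assms by (simp add: cball_eq_atLeastAtMost)
  qed
  thus ?thesis by (simp add: closed_limpt)
qed

text \<open>The set is closed, so its part in a compact interval is compact, and a compact discrete
  set is finite. Conversely, an accumulation point would put infinitely many of its points into a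
  bounded interval.\<close>

lemma discrete_non_affine_points_iff_finite:
  "discrete (non_affine_points f) \<longleftrightarrow> (\<forall>u v. finite (non_affine_points f \<inter> {u..v}))"
proof
  assume *: "discrete (non_affine_points f)"
  show "\<forall>u v. finite (non_affine_points f \<inter> {u..v})"
  proof (intro allI)
    fix u v
    have "discrete (non_affine_points f \<inter> {u..v})"
      using * by (rule discrete_subset) simp
    moreover have "compact (non_affine_points f \<inter> {u..v})"
      by (simp add: closed_Int_compact closed_non_affine_points)
    ultimately show "finite (non_affine_points f \<inter> {u..v})"
      using discrete_compact_finite_iff by blast
  qed
next
  assume *: "\<forall>u v. finite (non_affine_points f \<inter> {u..v})"
  have "\<not> x islimpt non_affine_points f" for x
  proof
    assume "x islimpt non_affine_points f"
    hence "infinite (non_affine_points f \<inter> cball x 1)"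
      by (metis islimpt_eq_infinite_cball zero_less_one)
    thus False
      using * by (simp add: cball_eq_atLeastAtMost)
  qed
  thus "discrete (non_affine_points f)"
    by (simp add: discrete_non_affine_points_iff islimpt_iff_eventually)
qed

lemma strict_antimono_on_UNIV_eq_iff:
  fixes f :: "'a::linorder \<Rightarrow> 'b::linorder"
  assumes "strict_antimono_on UNIV f"
  shows "f x = f y \<longleftrightarrow> x = y"
  using strict_antimono_on_UNIV_le_iff[OF assms] by (metis order_antisym order_refl)

section \<open>Monotone sequences indexed by the integers\<close>

lemma int_mono_if_step:
  fixes a :: "int \<Rightarrow> 'a::order"
  assumes step: "\<And>n. a n \<le> a (n + 1)" and "m \<le> n"
  shows "a m \<le> a n"
  using \<open>m \<le> n\<close>
proof (induction n rule: int_ge_induct)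
  case (step i)
  thus ?case using assms(1) order_trans by blast
qed simp

lemma int_Icc_cover:
  fixes a :: "int \<Rightarrow> 'a::linorder"
  assumes step: "\<And>n. a n \<le> a (n + 1)" and x: "a m \<le> x" "x \<le> a n"
  obtains k where "a k \<le> x" "x \<le> a (k + 1)"
proof -
  have "\<exists>k. a k \<le> x \<and> x \<le> a (k + 1)"
  proof (rule ccontr)
    assume "\<nexists>k. a k \<le> x \<and> x \<le> a (k + 1)"
    hence *: "a (k + 1) < x" if "a k \<le> x" for k
      using that by (meson linorder_not_less)
    have "a k < x" if "m + 1 \<le> k" for k
      using that
    proof (induction k rule: int_ge_induct)
      case base
      show ?case using *[OF x(1)] .
    next
      case (step i)
      show ?case using *[of i] step.IH by simp
    qed
    \<comment> \<open>The maximum covers the case \<open>n \<le> m\<close>, where the induction does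
      not reach \<open>n\<close>.\<close>
    hence "a (max (m + 1) n) < x" by simp
    moreover have "a n \<le> a (max (m + 1) n)"
      using step by (rule int_mono_if_step) simp
    ultimately show False using x(2) by simp
  qed
  thus ?thesis using that by blast
qed

section \<open>An increasing map \<open>f\<close> reversed by a decreasing map
  \<open>h\<close>\<close>

locale reversal =
  fixes f h :: "real \<Rightarrow> real"
  assumes mono: "strict_mono f" and surj_f: "surj f"
    and anti: "strict_antimono_on UNIV h" and surj_h: "surj h"
    and fhf: "f (h (f x)) = h x"
begin

definition "h' = inv_into UNIV h"

definition "F = {x. h (h x) = x}"

lemma f_simps [simp]: "f x < f y \<longleftrightarrow> x < y" "f x \<le> f y \<longleftrightarrow> x \<le> y" "f x = f y \<longleftrightarrow> x = y"
  using mono by (auto simp: strict_mono_less strict_mono_less_eq strict_mono_eq)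

lemma h_simps [simp]: "h x < h y \<longleftrightarrow> y < x" "h x \<le> h y \<longleftrightarrow> y \<le> x" "h x = h y \<longleftrightarrow> x = y"
  using anti by (rule strict_antimono_on_UNIV_less_iff strict_antimono_on_UNIV_le_iff
      strict_antimono_on_UNIV_eq_iff)+

lemma h_h' [simp]: "h (h' x) = x"
  unfolding h'_def by (rule surj_f_inv_f[OF surj_h])

lemma h'_h [simp]: "h' (h x) = x"
  using h_h'[of "h x"] h_simps(3) by blast

lemma h'_less [simp]: "h' x < h' y \<longleftrightarrow> y < x"
  using h_simps(1)[of "h' y" "h' x"] by (simp del: h_simps)

lemma h'_le [simp]: "h' x \<le> h' y \<longleftrightarrow> y \<le> x"
  using h_simps(2)[of "h' y" "h' x"] by (simp del: h_simps)

lemma fh'f: "f (h' (f x)) = h' x"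
proof -
  have "f (h (f (h' (f x)))) = f x"
    by (simp add: fhf)
  hence "h (f (h' (f x))) = x"
    by simp
  thus ?thesis by (metis h'_h)
qed

text \<open>Expand the inner \<open>h x\<close> by \<open>fhf\<close> and collapse the outer
  occurrence. This commutation makes \<open>F\<close> invariant under \<open>f\<close>.\<close>

lemma hh_f: "h (h (f x)) = f (h (h x))"
proof -
  have "f (h (h x)) = f (h (f (h (f x))))"
    by (simp only: fhf)
  also have "\<dots> = h (h (f x))"
    by (rule fhf)
  finally show ?thesis ..
qed

lemma f_in_F [simp]: "f x \<in> F \<longleftrightarrow> x \<in> F"
  by (simp add: F_def hh_f)

lemma h_in_F [simp]: "h x \<in> F \<longleftrightarrow> x \<in> F"
  by (simp add: F_def)

lemma h'_in_F [simp]: "h' x \<in> F \<longleftrightarrow> x \<in> F"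
  using h_in_F[of "h' x"] by (simp del: h_in_F)

lemma h'_eq_h: "x \<in> F \<Longrightarrow> h' x = h x"
  unfolding F_def using h'_h[of "h x"] by simp

lemma fixed_in_F: "h x = x \<Longrightarrow> x \<in> F"
  by (simp add: F_def)

end

section \<open>Gluing \<open>h\<close> and its inverse along a set\<close>

text \<open>\<open>U\<close> is the region on which the glued map follows \<open>h\<close>. Its
  symmetry is demanded only off \<open>F\<close>, because both branches agree on \<open>F\<close>.
  \<open>U_B\<close> confines the boundary of \<open>U\<close> to \<open>B\<close>: a segment that
  leaves \<open>U\<close> meets \<open>B\<close>.\<close>

locale half_line = reversal +
  fixes U B :: "real set"
  assumes U_h: "x \<notin> F \<Longrightarrow> x \<in> U \<longleftrightarrow> h x \<notin> U"
    and U_f: "x \<notin> F \<Longrightarrow> f x \<in> U \<longleftrightarrow> x \<in> U"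
    and B_F: "B \<subseteq> F"
    and U_B: "x \<in> U \<Longrightarrow> y \<notin> U \<Longrightarrow> \<exists>z\<in>B. min x y \<le> z \<and> z \<le> max x y"
begin

definition "\<sigma> x = (if x \<in> U then h x else h' x)"

lemma \<sigma>_F: "x \<in> F \<Longrightarrow> \<sigma> x = h x"
  by (simp add: \<sigma>_def h'_eq_h)

text \<open>Off \<open>F\<close>, either branch moves a point to the other side of \<open>U\<close>,
  so the second application uses the opposite branch and undoes the first.\<close>

lemma \<sigma>_\<sigma>: "\<sigma> (\<sigma> x) = x"
proof (cases "x \<in> F")
  case True
  thus ?thesis by (simp add: \<sigma>_F) (simp add: F_def)
next
  case False
  show ?thesis
  proof (cases "x \<in> U")
    case True
    thus ?thesis using U_h[OF False] by (simp add: \<sigma>_def)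
  next
    case notU: False
    have "h' x \<in> U"
      using U_h[of "h' x"] False notU by simp
    thus ?thesis using notU by (simp add: \<sigma>_def)
  qed
qed

lemma f_\<sigma>_f: "f (\<sigma> (f x)) = \<sigma> x"
proof (cases "x \<in> F")
  case True
  thus ?thesis by (simp add: \<sigma>_F fhf)
next
  case False
  thus ?thesis using U_f by (simp add: \<sigma>_def fhf fh'f)
qed

text \<open>On one side of \<open>U\<close> a single decreasing branch is used. Across the boundary,
  compare both values with that at a point of \<open>F\<close> in between, where the branches agree;
  strictness comes from the injectivity of an involution.\<close>

lemma \<sigma>_less: assumes "x < y" shows "\<sigma> y < \<sigma> x"
proof (cases "x \<in> U \<longleftrightarrow> y \<in> U")
  case True
  thus ?thesis using assms by (simp add: \<sigma>_def)
next
  case False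
  then obtain z where z: "z \<in> F" "x \<le> z" "z \<le> y"
    using U_B[of x y] U_B[of y x] B_F assms by (auto simp: min_def max_def split: if_splits)
  have le: "\<sigma> z \<le> \<sigma> x" "\<sigma> y \<le> \<sigma> z"
    using z h_simps(2)[of z x] h'_le[of z x] h_simps(2)[of y z] h'_le[of y z] h'_eq_h[OF z(1)]
    by (auto simp: \<sigma>_F \<sigma>_def simp del: h_simps h'_le)
  moreover have "\<sigma> x \<noteq> \<sigma> y"
    using assms \<sigma>_\<sigma> by (metis order_less_irrefl)
  ultimately show ?thesis by linarith
qed

lemma antimono_\<sigma>: "strict_antimono_on UNIV \<sigma>"
  using \<sigma>_less by (auto intro!: monotone_onI)

lemma surj_\<sigma>: "surj \<sigma>"
  using \<sigma>_\<sigma> by (metis surjI)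

text \<open>A point off the closed set \<open>B\<close> has a ball that misses \<open>B\<close>, and
  such a ball lies on one side of \<open>U\<close>. Near the point the glued map is therefore a
  single branch.\<close>

lemma non_affine_points_\<sigma>:
  assumes "closed B"
  shows "non_affine_points \<sigma> \<subseteq> non_affine_points h \<union> non_affine_points h' \<union> B"
proof -
  have "locally_affine_at \<sigma> x"
    if x: "locally_affine_at h x" "locally_affine_at h' x" "x \<notin> B" for x
  proof -
    obtain e where e: "e > 0" "ball x e \<subseteq> - B"
      using x(3) assms by (metis ComplI closed_def openE)
    have "y \<in> U \<longleftrightarrow> x \<in> U" if "y \<in> ball x e" for y
    proof (rule ccontr)
      assume "\<not> ?thesis"
      then obtain z where z: "z \<in> B" "min x y \<le> z" "z \<le> max x y"
        using U_B[of x y] U_B[of y x] by (auto simp: min.commute max.commute)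
      hence "z \<in> ball x e"
        using that by (auto simp: dist_real_def min_def max_def split: if_splits)
      thus False using z e by blast
    qed
    moreover have "\<forall>\<^sub>F y in nhds x. y \<in> ball x e"
      using e(1) by (intro eventually_nhds_in_open) auto
    ultimately have ev: "\<forall>\<^sub>F y in nhds x. \<sigma> y = (if x \<in> U then h y else h' y)"
      by (auto simp: \<sigma>_def elim: eventually_mono)
    obtain a b where "\<forall>\<^sub>F y in nhds x. (if x \<in> U then h y else h' y) = a * y + b"
      using x(1,2) by (cases "x \<in> U") (auto simp: locally_affine_at_def)
    with ev have "\<forall>\<^sub>F y in nhds x. \<sigma> y = a * y + b"
      by eventually_elim simp
    thus ?thesis unfolding locally_affine_at_def by blast
  qed
  thus ?thesis by (auto simp: non_affine_points_def)
qed

end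

section \<open>Two-sided orbits of \<open>f\<close>\<close>

context reversal
begin

definition orbit :: "real \<Rightarrow> int \<Rightarrow> real" where
  "orbit x n = (if 0 \<le> n then (f ^^ nat n) x else (inv_into UNIV f ^^ nat (- n)) x)"

lemma orbit_0 [simp]: "orbit x 0 = x"
  by (simp add: orbit_def)

lemma f_orbit: "f (orbit x n) = orbit x (n + 1)"
proof (cases "0 \<le> n")
  case True
  thus ?thesis by (simp add: orbit_def nat_add_distrib)
next
  case False
  then obtain k where k: "n = - int (Suc k)"
    by (metis int_cases of_nat_0_le_iff)
  have "orbit x (n + 1) = (inv_into UNIV f ^^ k) x"
    by (cases k) (auto simp: orbit_def k nat_add_distrib)
  moreover have "orbit x n = inv_into UNIV f ((inv_into UNIV f ^^ k) x)"
    by (simp add: orbit_def k nat_add_distrib)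
  ultimately show ?thesis
    by (simp add: surj_f_inv_f[OF surj_f])
qed

lemma f_eq_orbit_iff: "f x = orbit y n \<longleftrightarrow> x = orbit y (n - 1)"
  using f_orbit[of y "n - 1"] by (metis diff_add_cancel f_simps(3))

text \<open>\<open>h\<close> turns \<open>f\<close> into its inverse and so reverses the index; the
  one known value \<open>h x\<close> fixes the centre of the reflection.\<close>

lemma h_orbit:
  assumes "h x = orbit x m"
  shows "h (orbit x n) = orbit x (m - n)"
proof (induction n rule: int_induct[of _ 0])
  case (step1 i)
  have "f (h (f (orbit x i))) = orbit x (m - i)"
    using step1 by (simp add: fhf)
  thus ?case by (simp add: f_orbit f_eq_orbit_iff algebra_simps)
next
  case (step2 i)
  have "h (orbit x (i - 1)) = f (h (f (orbit x (i - 1))))"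
    by (simp add: fhf)
  thus ?case using step2 by (simp add: f_orbit algebra_simps)
qed (simp add: assms)

lemma orbit_le_orbit: "x \<le> y \<Longrightarrow> orbit x n \<le> orbit y n"
proof (induction n rule: int_induct[of _ 0])
  case (step1 i)
  thus ?case by (simp flip: f_orbit)
next
  case (step2 i)
  have "f (orbit x (i - 1)) \<le> f (orbit y (i - 1))"
    using step2 by (simp add: f_orbit)
  thus ?case by simp
qed simp

lemma orbit_in_F [simp]: "orbit x n \<in> F \<longleftrightarrow> x \<in> F"
proof (induction n rule: int_induct[of _ 0])
  case (step1 i)
  thus ?case by (simp flip: f_orbit)
next
  case (step2 i)
  thus ?case using f_in_F[of "orbit x (i - 1)"] by (simp add: f_orbit del: f_in_F)
qed simp

end

section \<open>The set \<open>U\<close> built from fixed points of \<open>h\<close> and of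
  \<open>f \<circ> h\<close>\<close>

locale based_reversal = reversal +
  fixes p q :: real
  assumes h_p: "h p = p" and fh_q: "f (h q) = q" and p_le: "p \<le> f p"
begin

abbreviation a where "a \<equiv> orbit p"
abbreviation b where "b \<equiv> orbit q"

lemma h_a: "h (a n) = a (- n)"
  using h_orbit[of p 0 n] by (simp add: h_p)

text \<open>The shift by one arises because \<open>f \<circ> h\<close>, rather than
  \<open>h\<close>, fixes \<open>q\<close>: this puts \<open>h q\<close> at index
  \<open>- 1\<close>.\<close>

lemma h_b: "h (b n) = b (- n - 1)"
proof -
  have "h q = b (- 1)"
    using fh_q f_eq_orbit_iff[of "h q" q 0] by simp
  thus ?thesis using h_orbit[of q "- 1" n] by (simp add: minus_diff_commute)
qed

lemma p_F [simp]: "p \<in> F"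
  by (rule fixed_in_F) (rule h_p)

lemma q_F [simp]: "q \<in> F"
  using h_b[of 0] h_b[of "- 1"] by (simp add: F_def)

text \<open>If \<open>q < p\<close>, the decreasing map \<open>f \<circ> h\<close> gives
  \<open>f p < q\<close>, against \<open>p \<le> f p\<close>. With \<open>q_le\<close>, proved in
  the same way, the two orbits interlace.\<close>

lemma p_le_q: "p \<le> q"
proof (rule ccontr)
  assume "\<not> p \<le> q"
  hence "f (h p) < f (h q)" by simp
  hence "f p < q" unfolding h_p fh_q .
  thus False using \<open>\<not> p \<le> q\<close> p_le by linarith
qed

lemma q_le: "q \<le> f p"
proof (rule ccontr)
  assume "\<not> q \<le> f p"
  hence "h q \<le> h p" using p_le by (simp only: h_simps)
  hence "f (h q) \<le> f p" by (simp add: h_p)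
  thus False using \<open>\<not> q \<le> f p\<close> fh_q by linarith
qed

lemma a_le_b: "a n \<le> b n"
  by (rule orbit_le_orbit) (rule p_le_q)

lemma b_le_a: "b n \<le> a (n + 1)"
proof -
  have "b n \<le> orbit (f p) n"
    by (rule orbit_le_orbit) (rule q_le)
  moreover have "orbit (f p) n = a (n + 1)"
  proof (induction n rule: int_induct[of _ 0])
    case base
    show ?case using f_orbit[of p 0] by simp
  next
    case (step1 i)
    thus ?case using f_orbit[of "f p" i] f_orbit[of p "i + 1"] by simp
  next
    case (step2 i)
    thus ?case using f_orbit[of "f p" "i - 1"] by (simp add: f_eq_orbit_iff)
  qed
  ultimately show ?thesis by simp
qed

lemma a_mono: "m \<le> n \<Longrightarrow> a m \<le> a n"
  by (rule int_mono_if_step[of a, OF order_trans[OF a_le_b b_le_a]])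

lemma a_cover:
  assumes "\<not> (\<forall>n. a n < x)" "\<not> (\<forall>n. x < a n)"
  obtains k where "a k \<le> x" "x \<le> a (k + 1)"
  using assms int_Icc_cover[of a _ x] a_mono by (metis linorder_not_less zle_add1_eq_le order_less_imp_le)

text \<open>\<open>h\<close> maps the segment from \<open>a n\<close> to \<open>b n\<close> onto the
  gap from \<open>b (- n - 1)\<close> to \<open>a (- n)\<close>, so taking the segments and leaving
  the gaps gives the required exchange. The second disjunct matters when the orbit is bounded above:
  \<open>h\<close> swaps the points above the whole orbit with those below it.\<close>

definition "U = {x. (\<exists>n. a n \<le> x \<and> x \<le> b n) \<or> (\<forall>n. a n < x)}"

definition "B = range a \<union> range b"

lemma B_F: "B \<subseteq> F"
  by (auto simp: B_def)

text \<open>By interlacing, a segment of index at most \<open>k\<close> ends no later than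
  \<open>b k\<close>, and one of larger index starts no earlier than \<open>a (k + 1)\<close>.
  Segments thus meet the gap at most in its endpoints, which lie in \<open>B\<close>.\<close>

lemma gap_notin_U:
  assumes "b k \<le> x" "x \<le> a (k + 1)" "x \<notin> B"
  shows "x \<notin> U"
proof
  assume "x \<in> U"
  moreover have "\<not> (\<forall>n. a n < x)"
    using assms(2) by (metis linorder_not_less)
  ultimately obtain n where n: "a n \<le> x" "x \<le> b n"
    by (auto simp: U_def)
  have "x = b k" if "n \<le> k"
    using a_mono[of "n + 1" "k"] b_le_a[of n] a_le_b[of k] n(2) assms(1) that
    by (cases "n = k") auto
  moreover have "x = a (k + 1)" if "n > k"
    using a_mono[of "k + 1" n] n(1) assms(2) that by simp
  ultimately show False using assms(3) by (cases "n \<le> k") (auto simp: B_def)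
qed

lemma half_line_U: "half_line f h U B"
proof unfold_locales
  fix x assume x: "x \<notin> F"
  hence xB: "x \<notin> B" and hB: "h x \<notin> B"
    using B_F h_in_F by blast+
  \<comment> \<open>Above the orbit, below it, in a segment, or in a gap: \<open>h\<close> exchanges
    the first two positions and the last two.\<close>
  consider "\<forall>n. a n < x" | "\<forall>n. x < a n" | k where "a k \<le> x" "x \<le> b k" | k where "b k \<le> x" "x \<le> a (k + 1)"
    using a_cover[of x] by (metis linear)
  thus "x \<in> U \<longleftrightarrow> h x \<notin> U"
  proof cases
    case 1
    have "h x < a n" for n
      using h_simps(1)[of x "a (- n)"] 1 by (simp add: h_a)
    hence "h x \<notin> U" unfolding U_def using a_le_b by (auto simp: not_le) (metis less_asym)+
    thus ?thesis using 1 by (simp add: U_def)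
  next
    case 2
    have "h x > a n" for n
      using h_simps(1)[of "a (- n)" x] 2 by (simp add: h_a)
    hence "h x \<in> U" by (simp add: U_def)
    moreover have "x \<notin> U"
      using 2 by (auto simp: U_def not_le) (metis less_asym)
    ultimately show ?thesis by simp
  next
    case (3 k)
    have "h x \<le> a (- k)" "b (- k - 1) \<le> h x"
      using 3 by (simp_all flip: h_a h_b)
    hence "h x \<notin> U"
      using gap_notin_U[of "- k - 1" "h x"] hB by simp
    thus ?thesis using 3 by (auto simp: U_def)
  next
    case (4 k)
    have "h x \<le> b (- k - 1)" "a (- k - 1) \<le> h x"
      using 4 h_simps(2)[of "a (k + 1)" x] by (simp_all add: h_a flip: h_b)
    hence "h x \<in> U" by (auto simp: U_def)
    thus ?thesis using gap_notin_U[OF 4 xB] by simp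
  qed
next
  fix x
  \<comment> \<open>\<open>f\<close> shifts the index of both orbits by one, and quantifying over
    all integers absorbs the shift.\<close>
  have "(\<exists>n. a n \<le> f x \<and> f x \<le> b n) \<longleftrightarrow> (\<exists>n. f (a n) \<le> f x \<and> f x \<le> f (b n))"
    unfolding f_orbit by (metis diff_add_cancel)
  moreover have "(\<forall>n. a n < f x) \<longleftrightarrow> (\<forall>n. f (a n) < f x)"
    unfolding f_orbit by (metis diff_add_cancel)
  ultimately show "f x \<in> U \<longleftrightarrow> x \<in> U"
    by (simp add: U_def)
next
  show "B \<subseteq> F" by (rule B_F)
next
  fix x y assume xy: "x \<in> U" "y \<notin> U"
  show "\<exists>z\<in>B. min x y \<le> z \<and> z \<le> max x y"
  proof (cases "\<forall>n. a n < x")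
    case True
    moreover from xy(2) obtain n where "y \<le> a n"
      by (auto simp: U_def not_less)
    ultimately show ?thesis
      by (intro bexI[of _ "a n"]) (auto simp: B_def min_le_iff_disj le_max_iff_disj intro: less_imp_le)
  next
    case False
    then obtain n where n: "a n \<le> x" "x \<le> b n"
      using xy(1) by (auto simp: U_def)
    moreover have "\<not> (a n \<le> y \<and> y \<le> b n)"
      using xy(2) by (auto simp: U_def)
    ultimately consider "y \<le> a n" "a n \<le> x" | "x \<le> b n" "b n \<le> y"
      by linarith
    thus ?thesis
      by cases (auto simp: B_def min_le_iff_disj le_max_iff_disj)
  qed
qed

text \<open>A point beyond the whole orbit on either side stays there under \<open>f\<close>, so
  \<open>f\<close> cannot carry a point off \<open>F\<close> across \<open>p\<close>. The boundary
  is then the single point \<open>p\<close>.\<close>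

lemma half_line_ray:
  assumes "\<And>x. x \<notin> F \<Longrightarrow> (\<forall>n. a n < x) \<or> (\<forall>n. x < a n)"
  shows "half_line f h {p..} {p}"
proof unfold_locales
  fix x assume x: "x \<notin> F"
  show "x \<in> {p..} \<longleftrightarrow> h x \<notin> {p..}"
    using h_simps(1)[of x p] x by (auto simp: h_p not_le not_less)
  show "f x \<in> {p..} \<longleftrightarrow> x \<in> {p..}"
    using assms[OF x]
  proof
    assume *: "\<forall>n. a n < x"
    \<comment> \<open>Both \<open>a 0\<close> and \<open>f (a (- 1))\<close> are
      \<open>p\<close>.\<close>
    have "a 0 < x" "f (a (- 1)) < f x"
      using * by (blast, simp)
    thus ?thesis by (simp add: f_orbit)
  next
    assume *: "\<forall>n. x < a n"
    have "x < a 0" "f x < f (a (- 1))"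
      using * by (blast, simp)
    thus ?thesis by (simp add: f_orbit)
  qed
qed (auto simp: min_le_iff_disj le_max_iff_disj)

end

section \<open>Breakpoints of \<open>h \<circ> h\<close> between successive orbit points\<close>

context based_reversal
begin

text \<open>\<open>h \<circ> h\<close> fixes the endpoints of the gap, and an affine map with two
  fixed points is the identity. Invariance of \<open>F\<close> under \<open>f\<close> carries this
  to all other gaps.\<close>

lemma gaps_subset_F:
  assumes "{a k<..<a (k + 1)} \<inter> non_affine_points (h \<circ> h) = {}"
  shows "{a n..a (n + 1)} \<subseteq> F"
proof -
  have gap: "{a k..a (k + 1)} \<subseteq> F"
  proof (cases "a k < a (k + 1)")
    case True
    obtain c d where cd: "\<And>x. x \<in> {a k<..<a (k + 1)} \<Longrightarrow> (h \<circ> h) x = c * x + d"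
      using assms by (rule affine_on_connected[OF open_greaterThanLessThan connected_Ioo]) blast
    have conth: "continuous_on A h" for A
      using continuous_on_strict_antimono_surj[OF anti surj_h] by (rule continuous_on_subset) simp
    \<comment> \<open>Continuity extends the affine formula from the open gap to its
      endpoints.\<close>
    have "continuous_on {a k..a (k + 1)} (\<lambda>x. h (h x) - c * x)"
      by (intro continuous_intros continuous_on_compose2[OF conth[of UNIV] conth]) auto
    hence hh: "h (h x) = c * x + d" if "x \<in> {a k..a (k + 1)}" for x
      using continuous_constant_on_closure[of "{a k<..<a (k + 1)}" "\<lambda>x. h (h x) - c * x" d x]
        cd True that by (simp add: closure_greaterThanLessThan algebra_simps)
    have "c * a k + d = a k" "c * a (k + 1) + d = a (k + 1)"
      using hh[of "a k"] hh[of "a (k + 1)"] True by (simp_all add: h_a add.commute)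
    hence "(c - 1) * (a (k + 1) - a k) = 0" "d = (1 - c) * a k"
      by (simp_all add: algebra_simps)
    hence "c = 1" "d = 0"
      using True by simp_all
    thus ?thesis using hh by (auto simp: F_def)
  next
    case False
    hence "{a k..a (k + 1)} \<subseteq> {a k}" by auto
    thus ?thesis using orbit_in_F p_F by blast
  qed
  show ?thesis
  proof (induction n rule: int_induct[of _ k])
    case (step1 i)
    show ?case
    proof
      fix x assume x: "x \<in> {a (i + 1)..a (i + 1 + 1)}"
      obtain y where y: "x = f y"
        using surj_f by (metis surjD)
      have "f (a i) \<le> f y" "f y \<le> f (a (i + 1))"
        using x unfolding f_orbit y by simp_all
      hence "y \<in> F" using step1.IH by auto
      thus "x \<in> F" by (simp add: y)
    qed
  next
    case (step2 i)
    show ?case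
    proof
      fix x assume "x \<in> {a (i - 1)..a (i - 1 + 1)}"
      hence "f (a (i - 1)) \<le> f x" "f x \<le> f (a i)"
        by simp_all
      hence "f x \<in> F" using step2.IH unfolding f_orbit by auto
      thus "x \<in> F" by simp
    qed
  qed (rule gap)
qed

text \<open>The open gaps are pairwise disjoint, so choosing a point of \<open>S\<close> in each is
  injective.\<close>

lemma finite_gaps:
  assumes "finite S" "\<And>k. k \<in> K \<Longrightarrow> \<exists>z\<in>S. a k < z \<and> z < a (k + 1)"
  shows "finite K"
proof -
  from assms(2) obtain z where z: "\<And>k. k \<in> K \<Longrightarrow> z k \<in> S \<and> a k < z k \<and> z k < a (k + 1)"
    by metis
  have "z j < z k" if "j \<in> K" "k \<in> K" "j < k" for j k
    using z[OF that(1)] z[OF that(2)] a_mono[of "j + 1" k] that(3) by linarith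
  hence "inj_on z K"
    by (metis inj_onI linorder_less_linear order_less_irrefl)
  moreover have "z ` K \<subseteq> S" using z by blast
  ultimately show ?thesis
    using assms(1) by (metis finite_imageD finite_subset)
qed

lemma half_line_ray':
  assumes "{a k<..<a (k + 1)} \<inter> non_affine_points (h \<circ> h) = {}"
  shows "half_line f h {p..} {p}"
proof (rule half_line_ray)
  fix x assume "x \<notin> F"
  thus "(\<forall>n. a n < x) \<or> (\<forall>n. x < a n)"
    using gaps_subset_F[OF assms] by (metis a_cover atLeastAtMost_iff subsetD)
qed

text \<open>Finitely many breakpoints cannot meet all of the gaps, so some gap contains
  none.\<close>

lemma half_line_if_finite:
  assumes "finite (non_affine_points (h \<circ> h))"
  shows "half_line f h {p..} {p}"
proof -
  have "\<not> finite (UNIV :: int set)" by simp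
  then obtain k where "\<not> (\<exists>z\<in>non_affine_points (h \<circ> h). a k < z \<and> z < a (k + 1))"
    using finite_gaps[OF assms, of UNIV] by blast
  hence "{a k<..<a (k + 1)} \<inter> non_affine_points (h \<circ> h) = {}" by auto
  thus ?thesis by (rule half_line_ray')
qed

text \<open>If some gap is free of breakpoints, the ray serves. Otherwise every gap contains one,
  which forces the orbit to be unbounded both ways, and then \<open>B\<close> is locally
  finite.\<close>

lemma half_line_if_locally_finite:
  assumes fin: "\<And>u v. finite (non_affine_points (h \<circ> h) \<inter> {u..v})"
  obtains U C where "half_line f h U C" "\<And>u v. finite (C \<inter> {u..v})"
proof (cases "\<exists>k. {a k<..<a (k + 1)} \<inter> non_affine_points (h \<circ> h) = {}")
  case True
  thus ?thesis using half_line_ray' by (intro that[of "{p..}" "{p}"]) auto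
next
  case False
  hence gap: "\<exists>z\<in>non_affine_points (h \<circ> h). a k < z \<and> z < a (k + 1)" for k
    by (metis disjoint_iff greaterThanLessThan_iff)
  have above: "\<exists>n. x < a n" for x
  proof (rule ccontr)
    assume "\<nexists>n. x < a n"
    hence x: "a n \<le> x" for n by (simp add: not_less)
    \<comment> \<open>An upper bound \<open>x\<close> of the orbit would trap the breakpoints of all
      gaps of index at least \<open>0\<close> in one bounded interval.\<close>
    have "\<exists>z\<in>non_affine_points (h \<circ> h) \<inter> {p..x}. a k < z \<and> z < a (k + 1)" if "k \<in> {0..}" for k
    proof -
      obtain z where z: "z \<in> non_affine_points (h \<circ> h)" "a k < z" "z < a (k + 1)"
        using gap by blast
      moreover have "p \<le> z" "z \<le> x"
        using a_mono[of 0 k] x[of "k + 1"] z that by auto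
      ultimately show ?thesis by auto
    qed
    hence "finite {0::int..}"
      by (rule finite_gaps[OF fin])
    thus False by (simp add: infinite_Ici)
  qed
  have below: "\<exists>n. a n < x" for x
  proof -
    obtain n where "h x < a n" using above by blast
    hence "h x < h (a (- n))" by (simp add: h_a)
    thus ?thesis by auto
  qed
  have "finite (B \<inter> {u..v})" for u v
  proof -
    obtain m n where mn: "a m < u" "v < a n" using above below by blast
    \<comment> \<open>The index of \<open>b\<close> may start one lower because \<open>b k\<close>
      can reach up to \<open>a (k + 1)\<close>.\<close>
    have "B \<inter> {u..v} \<subseteq> a ` {m..n} \<union> b ` {m - 1..n}"
    proof
      fix x assume x: "x \<in> B \<inter> {u..v}"
      then consider k where "x = a k" | k where "x = b k" by (auto simp: B_def)
      thus "x \<in> a ` {m..n} \<union> b ` {m - 1..n}"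
      proof cases
        case (1 k)
        hence "m \<le> k" "k \<le> n"
          using x mn a_mono[of k m] a_mono[of n k] by (fastforce simp: not_le[symmetric])+
        thus ?thesis using 1 by auto
      next
        case (2 k)
        hence "m - 1 \<le> k" "k \<le> n"
          using x mn a_mono[of "k + 1" m] a_mono[of n k] a_le_b[of k] b_le_a[of k] by fastforce+
        thus ?thesis using 2 by auto
      qed
    qed
    thus ?thesis by (rule finite_subset) simp
  qed
  thus ?thesis using half_line_U that by blast
qed

end

section \<open>Choice of the base points\<close>

lemma (in reversal) reversal_inv_into: "reversal (inv_into UNIV f) h"
proof
  have finv: "f (inv_into UNIV f x) = x" for x
    by (rule surj_f_inv_f[OF surj_f])
  show "strict_mono (inv_into UNIV f)"
    by (rule strict_monoI) (metis finv f_simps(1))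
  show "surj (inv_into UNIV f)"
    by (metis finv f_simps(3) surjI)
  show "inv_into UNIV f (h (inv_into UNIV f x)) = h x" for x
    using fhf[of "inv_into UNIV f x"] finv by (metis f_simps(3))
qed (use anti surj_h in auto)

text \<open>Passing to \<open>f\<^sup>-\<^sup>1\<close> if necessary, \<open>f\<close> may be assumed to move the fixed point of \<open>h\<close> upwards.\<close>

lemma (in reversal) obtain_based:
  obtains g p q where "based_reversal g h p q"
    "\<And>s x. (\<And>x. g (s (g x)) = s x) \<Longrightarrow> f (s (f x)) = s x"
proof -
  obtain p where p: "h p = p"
    using antimono_fixed_point[OF anti surj_h] .
  have based: "\<exists>q. based_reversal g h p q" if g: "reversal g h" "p \<le> g p" for g
  proof -
    interpret g: reversal g h by (rule g)
    have "strict_antimono_on UNIV (g \<circ> h)"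
      by (rule monotone_onI) simp
    moreover have "surj (g \<circ> h)"
      by (intro comp_surj g.surj_h g.surj_f)
    ultimately obtain q where "(g \<circ> h) q = q"
      by (rule antimono_fixed_point)
    hence "based_reversal g h p q"
      using p g(2) by unfold_locales auto
    thus ?thesis ..
  qed
  show ?thesis
  proof (cases "p \<le> f p")
    case True
    thus ?thesis using based[OF reversal_axioms] that by blast
  next
    case False
    define g where "g = inv_into UNIV f"
    have fg: "f (g x) = x" for x
      unfolding g_def by (rule surj_f_inv_f[OF surj_f])
    hence gf: "g (f x) = x" for x
      by (metis f_simps(3))
    have "f p \<le> f (g p)" using False fg by simp
    then obtain q where q: "based_reversal g h p q"
      using based[of g] reversal_inv_into unfolding g_def f_simps by blast
    \<comment> \<open>At \<open>f x\<close> the hypothesis reads \<open>g (s x) = s (f x)\<close>;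
      then apply \<open>f\<close>.\<close>
    have "f (s (f x)) = s x" if "\<And>x. g (s (g x)) = s x" for s x
      using that[of "f x"] by (metis fg gf)
    thus ?thesis using that q by blast
  qed
qed

section \<open>Increasing conjugators with finitely many breakpoints\<close>

lemma increasing_conj_to_inverse_imp_id:
  fixes f h :: "real \<Rightarrow> real"
  assumes f: "strict_mono f" "surj f" "finite (non_affine_points f)"
    and h: "strict_mono h" "surj h" "finite (non_affine_points h)"
    and fhf: "\<And>x. f (h (f x)) = h x"
  shows "f x = x"
proof (rule ccontr)
  assume "f x \<noteq> x"
  have f_simps [simp]: "f x < f y \<longleftrightarrow> x < y" "f x = f y \<longleftrightarrow> x = y" for x y
    using f(1) by (auto simp: strict_mono_less strict_mono_eq)
  have h_simps [simp]: "h x < h y \<longleftrightarrow> x < y" "h x = h y \<longleftrightarrow> x = y" for x y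
    using h(1) by (auto simp: strict_mono_less strict_mono_eq)
  define S where "S = {x. f x \<noteq> x}"
  \<comment> \<open>This open down-set replaces the supremum of \<open>S\<close>, so bounded and
    unbounded \<open>S\<close> are treated alike.\<close>
  define J where "J = {x. \<exists>y\<in>S. x < y}"
  have h_S: "h y \<in> S \<longleftrightarrow> y \<in> S" for y
  proof -
    have "f (h y) = h y \<longleftrightarrow> f y = y"
      using fhf[of y] by (metis f_simps(2) h_simps(2))
    thus ?thesis by (simp add: S_def)
  qed
  have f_S: "f y \<in> S \<longleftrightarrow> y \<in> S" for y
    by (simp add: S_def)
  \<comment> \<open>\<open>S\<close> has no greatest element: either \<open>f\<close> or its inverse
    moves \<open>y\<close> up, to another point of \<open>S\<close>.\<close>
  have S_J: "y \<in> J" if "y \<in> S" for y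
  proof (cases "y < f y")
    case True
    thus ?thesis using that f_S by (auto simp: J_def)
  next
    case False
    obtain z where z: "y = f z" using f(2) by (metis surjD)
    have "y < z" "z \<in> S"
      using False that z f_S by (auto simp: S_def)
    thus ?thesis by (auto simp: J_def)
  qed
  have f_J: "f y \<in> J \<longleftrightarrow> y \<in> J" for y
  proof -
    have "(\<exists>z\<in>S. f y < z) \<longleftrightarrow> (\<exists>z\<in>S. f y < f z)"
      using f_S f(2) by (metis surjD)
    thus ?thesis by (simp add: J_def)
  qed
  have h_J: "h y \<in> J \<longleftrightarrow> y \<in> J" for y
  proof -
    have "(\<exists>z\<in>S. h y < z) \<longleftrightarrow> (\<exists>z\<in>S. h y < h z)"
      using h_S h(2) by (metis surjD)
    thus ?thesis by (simp add: J_def)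
  qed
  have J_down: "v \<in> J" if "u \<in> J" "v \<le> u" for u v
    using that by (auto simp: J_def intro: order_le_less_trans)
  have J_up: "\<exists>w\<in>J. v < w" if "v \<in> J" for v
    using that S_J by (auto simp: J_def)
  define N where "N = (non_affine_points f \<union> non_affine_points h) \<inter> J"
  have "finite N" using f(3) h(3) by (simp add: N_def)
  have "x \<in> J" using \<open>f x \<noteq> x\<close> S_J by (simp add: S_def)
  \<comment> \<open>No breakpoint in \<open>J\<close> lies above \<open>u\<close>; inserting
    \<open>x\<close> keeps the set nonempty.\<close>
  define u where "u = Max (insert x N)"
  have "u \<in> insert x N"
    unfolding u_def using \<open>finite N\<close> by (intro Max_in) auto
  hence u_J: "u \<in> J" using \<open>x \<in> J\<close> by (auto simp: N_def)
  have u_ge: "y \<le> u" if "y \<in> N" for y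
    unfolding u_def using that \<open>finite N\<close> by simp
  define I where "I = {u<..} \<inter> J"
  have "J = (\<Union>y\<in>S. {..<y})" by (auto simp: J_def)
  hence "open I" unfolding I_def by (auto intro!: open_Int open_UN)
  have "is_interval I"
    unfolding is_interval_1 I_def using J_down by fastforce
  hence "connected I" by (simp add: is_interval_connected_1)
  have "I \<inter> (non_affine_points f \<union> non_affine_points h) = {}"
    using u_ge by (fastforce simp: I_def N_def)
  hence NI: "I \<inter> non_affine_points f = {}" "I \<inter> non_affine_points h = {}" by blast+
  obtain c d where cd: "\<And>x. x \<in> I \<Longrightarrow> f x = c * x + d"
    using affine_on_connected[OF \<open>open I\<close> \<open>connected I\<close> NI(1)] by blast
  obtain c' d' where cd': "\<And>x. x \<in> I \<Longrightarrow> h x = c' * x + d'"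
    using affine_on_connected[OF \<open>open I\<close> \<open>connected I\<close> NI(2)] by blast
  obtain v1 where v1: "u = f v1" using f(2) by (metis surjD)
  obtain v2 where v2: "u = h v2" using h(2) by (metis surjD)
  obtain v3 where v3: "v2 = f v3" using f(2) by (metis surjD)
  have J3: "v1 \<in> J" "v3 \<in> J"
    using u_J f_J h_J v1 v2 v3 by metis+
  \<comment> \<open>For \<open>t\<close> above \<open>w\<close>, the points \<open>t\<close>,
    \<open>f t\<close> and \<open>h (f t)\<close> all exceed \<open>u\<close>, so the affine
    formulas apply at every stage of \<open>f h f\<close>.\<close>
  define w where "w = max u (max v1 v3)"
  have "w \<in> J" using J3 u_J by (auto simp: w_def max_def)
  then obtain y where y: "y \<in> J" "w < y" using J_up by blast
  then obtain z where z: "z \<in> J" "y < z" using J_up by blast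
  have in_I: "t \<in> I" "f t \<in> I" "h (f t) \<in> I" if "t \<in> J" "w < t" for t
  proof -
    have t: "u < t" "v1 < t" "v3 < t"
      using that(2) by (simp_all add: w_def)
    have "u < f t"
      using t(2) by (simp add: v1)
    moreover have "u < h (f t)"
      unfolding v2 v3 using t(3) by simp
    ultimately show "t \<in> I" "f t \<in> I" "h (f t) \<in> I"
      using that(1) f_J h_J t(1) by (auto simp: I_def)
  qed
  have eq: "c * (c' * (c * t + d) + d') + d = c' * t + d'" if "t \<in> J" "w < t" for t
    using fhf[of t] cd cd' in_I[OF that] by metis
  have yI: "y \<in> I" and zI: "z \<in> I" using y z in_I by auto
  have "c * y + d < c * z + d" "c' * y + d' < c' * z + d'"
    using z(2) by (simp_all flip: cd[OF yI] cd[OF zI] cd'[OF yI] cd'[OF zI])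
  hence pos: "c > 0" "c' > 0"
    using z(2) by (auto simp: mult_less_cancel_left)
  have "c * (c' * (c * y + d) + d') + d = c' * y + d'" "c * (c' * (c * z + d) + d') + d = c' * z + d'"
    using eq y z by auto
  \<comment> \<open>Subtracting the equations at \<open>y\<close> and \<open>z\<close> eliminates
    the intercepts.\<close>
  hence "c' * (z - y) * (c\<^sup>2 - 1) = 0"
    by (simp add: algebra_simps power2_eq_square)
  hence "c\<^sup>2 = 1" using pos z(2) by simp
  hence c: "c = 1" using pos(1) by (simp add: power2_eq_1_iff)
  hence "(c' + 1) * d = 0"
    using eq[OF y] by (simp add: algebra_simps)
  hence d: "d = 0" using pos(2) by simp
  \<comment> \<open>\<open>f\<close> is now the identity on \<open>I\<close>, yet \<open>I\<close>
    contains a moved point.\<close>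
  obtain s where s: "s \<in> S" "u < s" using u_J by (auto simp: J_def)
  hence "s \<in> I" using S_J by (simp add: I_def)
  thus False using cd[of s] c d s(1) by (simp add: S_def)
qed

section \<open>Groups of homeomorphisms of the line that contain \<open>uminus\<close>\<close>

locale homeo_group = group G for G :: "(real \<Rightarrow> real) monoid" (structure) +
  assumes carrier_subset: "carrier G \<subseteq> carrier homeo_real"
    and mult_comp: "monoid.mult G = (\<circ>)"
    and one_id: "\<one> = id"
    and uminus_closed: "uminus \<in> carrier G"
begin

lemma carrier_cases:
  assumes "f \<in> carrier G"
  obtains "strict_mono f" "surj f" | "strict_antimono_on UNIV f" "surj f"
  using assms carrier_subset carrier_homeo_real_iff by blast

lemma comp_closed: "f \<in> carrier G \<Longrightarrow> g \<in> carrier G \<Longrightarrow> f \<circ> g \<in> carrier G"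
  using m_closed by (simp add: mult_comp)

lemma inv_into_closed:
  assumes "f \<in> carrier G"
  shows "inv_into UNIV f \<in> carrier G"
proof -
  have "f \<circ> inv f = id" "inv f \<circ> f = id"
    using r_inv[OF assms] l_inv[OF assms] by (simp_all add: mult_comp one_id)
  hence "inv_into UNIV f = inv f" by (rule inv_unique_comp)
  thus ?thesis using assms by simp
qed

lemma orientation_reversing_iff:
  assumes "f \<in> carrier G"
  shows "(\<exists>h\<in>orientation_reversing G. h \<otimes> f \<otimes> inv h = inv f) \<longleftrightarrow>
    (\<exists>h\<in>carrier G. strict_antimono_on UNIV h \<and> (\<forall>x. f (h (f x)) = h x))"
  using assms conj_eq_inv_iff[OF assms]
  by (auto simp: orientation_reversing_def mult_comp fun_eq_iff)

lemma reversible_iff': "f \<in> carrier G \<Longrightarrow> reversible G f \<longleftrightarrow> (\<exists>h\<in>carrier G. \<forall>x. f (h (f x)) = h x)"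
  by (simp add: reversible_iff mult_comp fun_eq_iff)

lemma strongly_reversible_iff':
  "f \<in> carrier G \<Longrightarrow> strongly_reversible G f \<longleftrightarrow>
    (\<exists>s\<in>carrier G. (\<forall>x. s (s x) = x) \<and> (\<forall>x. f (s (f x)) = s x))"
  by (simp add: strongly_reversible_iff mult_comp one_id fun_eq_iff)

text \<open>An increasing involution is the identity. If the given involution is increasing,
  \<open>f\<close> is thus its own inverse, hence itself the identity, and \<open>uminus\<close>
  reverses it.\<close>

lemma involution_imp_orientation_reversing:
  assumes f: "f \<in> orientation_preserving G" and "strongly_reversible G f"
  shows "\<exists>h\<in>carrier G. strict_antimono_on UNIV h \<and> (\<forall>x. f (h (f x)) = h x)"
proof -
  have fG: "f \<in> carrier G" "strict_mono f"
    using f by (auto simp: orientation_preserving_def)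
  have invol_id: "s x = x" if s: "strict_mono s" "\<And>x. s (s x) = x" for s :: "real \<Rightarrow> real" and x
    using strict_mono_less[OF s(1), of x "s x"] strict_mono_less[OF s(1), of "s x" x] s(2)[of x]
    by linarith
  obtain s where s: "s \<in> carrier G" "\<And>x. s (s x) = x" "\<And>x. f (s (f x)) = s x"
    using assms(2) fG by (auto simp: strongly_reversible_iff')
  from s(1) show ?thesis
  proof (cases rule: carrier_cases)
    case 1
    hence "s x = x" for x using s(2) invol_id by blast
    hence "f (f x) = x" for x using s(3) by metis
    hence "f x = x" for x using fG(2) invol_id by blast
    thus ?thesis using uminus_closed
      by (intro bexI[of _ uminus]) (auto intro: monotone_onI)
  next
    case 2
    thus ?thesis using s by blast
  qed
qed

text \<open>What remains for each group is that it contains the glued map. The map \<open>g\<close>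
  may be the inverse of \<open>f\<close>, but \<open>half_line.\<sigma>\<close> depends only on
  \<open>h\<close> and \<open>U\<close>, and reversing \<open>g\<close> entails reversing
  \<open>f\<close>.\<close>

lemma strongly_reversible_if_half_line:
  assumes f: "f \<in> carrier G" "strict_mono f"
    and h: "h \<in> carrier G" "strict_antimono_on UNIV h" "\<And>x. f (h (f x)) = h x"
    and ex: "\<And>g p q. based_reversal g h p q \<Longrightarrow> \<exists>U C. half_line g h U C \<and> half_line.\<sigma> h U \<in> carrier G"
  shows "strongly_reversible G f"
proof -
  have "surj f" "surj h"
    using f(1) h(1) carrier_subset by (auto simp: carrier_homeo_real_iff)
  then interpret reversal f h
    using f h by unfold_locales auto
  obtain g p q where g: "based_reversal g h p q"
    and gf: "\<And>s x. (\<And>x. g (s (g x)) = s x) \<Longrightarrow> f (s (f x)) = s x"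
    using obtain_based by blast
  obtain U C where UC: "half_line g h U C" and G: "half_line.\<sigma> h U \<in> carrier G"
    using ex[OF g] by blast
  have "\<And>x. f (half_line.\<sigma> h U (f x)) = half_line.\<sigma> h U x"
    by (rule gf) (rule half_line.f_\<sigma>_f[OF UC])
  thus ?thesis
    using f(1) G half_line.\<sigma>_\<sigma>[OF UC] by (auto simp: strongly_reversible_iff')
qed

end

section \<open>The groups \<open>homeo_real\<close>, \<open>PL_real\<close> and
  \<open>PLF_real\<close>\<close>

lemma uminus_carrier_homeo_real: "uminus \<in> carrier homeo_real"
  by (auto simp: carrier_homeo_real_iff surj_def monotone_on_def intro: exI[of _ "- _"])

lemma non_affine_points_uminus: "non_affine_points uminus = {}"
proof -
  have "locally_affine_at uminus x" for x
    unfolding locally_affine_at_def by (rule exI[of _ "- 1"], rule exI[of _ 0]) simp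
  thus ?thesis by (simp add: non_affine_points_def)
qed

lemma carrier_PL_real_iff:
  "f \<in> carrier PL_real \<longleftrightarrow> f \<in> carrier homeo_real \<and> (\<forall>u v. finite (non_affine_points f \<inter> {u..v}))"
  by (simp add: PL_real_def discrete_non_affine_points_iff_finite)

lemma carrier_PLF_real_iff:
  "f \<in> carrier PLF_real \<longleftrightarrow> f \<in> carrier homeo_real \<and> finite (non_affine_points f)"
  by (simp add: PLF_real_def)

lemma homeo_group_homeo_real: "homeo_group homeo_real"
  using group_homeo_real uminus_carrier_homeo_real
  by (simp add: homeo_group_def homeo_group_axioms_def) (simp add: homeo_real_def)

lemma homeo_group_PL_real: "homeo_group PL_real"
  using group_PL_real uminus_carrier_homeo_real
  by (auto simp: homeo_group_def homeo_group_axioms_def carrier_PL_real_iff non_affine_points_uminus)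
    (simp_all add: PL_real_def homeo_real_def)

lemma homeo_group_PLF_real: "homeo_group PLF_real"
  using group_PLF_real uminus_carrier_homeo_real
  by (auto simp: homeo_group_def homeo_group_axioms_def carrier_PLF_real_iff non_affine_points_uminus)
    (simp_all add: PLF_real_def homeo_real_def)

lemma (in half_line) \<sigma>_carrier_homeo_real: "\<sigma> \<in> carrier homeo_real"
  using antimono_\<sigma> surj_\<sigma> by (simp add: carrier_homeo_real_iff)

section \<open>The three equivalences\<close>

lemma strongly_reversible_homeo_real_iff:
  assumes f: "f \<in> orientation_preserving homeo_real"
  shows "strongly_reversible homeo_real f \<longleftrightarrow>
    (\<exists>h\<in>orientation_reversing homeo_real.
      h \<otimes>\<^bsub>homeo_real\<^esub> f \<otimes>\<^bsub>homeo_real\<^esub> inv\<^bsub>homeo_real\<^esub> h = inv\<^bsub>homeo_real\<^esub> f)"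
proof -
  interpret homeo_group homeo_real by (rule homeo_group_homeo_real)
  have fG: "f \<in> carrier homeo_real" "strict_mono f"
    using f by (auto simp: orientation_preserving_def)
  have "strongly_reversible homeo_real f"
    if h: "h \<in> carrier homeo_real" "strict_antimono_on UNIV h" "\<And>x. f (h (f x)) = h x" for h
    using fG h
  proof (rule strongly_reversible_if_half_line)
    fix g p q assume "based_reversal g h p q"
    then interpret based_reversal g h p q .
    show "\<exists>U C. half_line g h U C \<and> half_line.\<sigma> h U \<in> carrier homeo_real"
      using half_line_U half_line.\<sigma>_carrier_homeo_real by blast
  qed
  thus ?thesis
    using involution_imp_orientation_reversing[OF f] fG by (auto simp: orientation_reversing_iff)
qed

lemma strongly_reversible_PL_real_iff:
  assumes f: "f \<in> orientation_preserving PL_real"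
  shows "strongly_reversible PL_real f \<longleftrightarrow>
    (\<exists>h\<in>orientation_reversing PL_real.
      h \<otimes>\<^bsub>PL_real\<^esub> f \<otimes>\<^bsub>PL_real\<^esub> inv\<^bsub>PL_real\<^esub> h = inv\<^bsub>PL_real\<^esub> f)"
proof -
  interpret homeo_group PL_real by (rule homeo_group_PL_real)
  have fG: "f \<in> carrier PL_real" "strict_mono f"
    using f by (auto simp: orientation_preserving_def)
  have "strongly_reversible PL_real f"
    if h: "h \<in> carrier PL_real" "strict_antimono_on UNIV h" "\<And>x. f (h (f x)) = h x" for h
    using fG h
  proof (rule strongly_reversible_if_half_line)
    fix g p q assume "based_reversal g h p q"
    then interpret based_reversal g h p q .
    have fin: "finite (non_affine_points k \<inter> {u..v})" if "k \<in> {h, h', h \<circ> h}" for k u v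
      using that h(1) inv_into_closed[OF h(1)] comp_closed[OF h(1) h(1)]
      by (auto simp: carrier_PL_real_iff h'_def)
    obtain U C where UC: "half_line g h U C" "\<And>u v. finite (C \<inter> {u..v})"
      using half_line_if_locally_finite fin by blast
    interpret L: half_line g h U C by (rule UC)
    \<comment> \<open>Local finiteness of \<open>C\<close> also makes it closed, so the gluing adds
      breakpoints only in \<open>C\<close>.\<close>
    have "finite (non_affine_points L.\<sigma> \<inter> {u..v})" for u v
    proof (rule finite_subset)
      show "non_affine_points L.\<sigma> \<inter> {u..v} \<subseteq> non_affine_points h \<inter> {u..v}
          \<union> non_affine_points h' \<inter> {u..v} \<union> C \<inter> {u..v}"
        using L.non_affine_points_\<sigma> UC(2) closed_if_finite_Int_atLeastAtMost by blast
    qed (use fin UC(2) in simp)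
    hence "L.\<sigma> \<in> carrier PL_real"
      using L.\<sigma>_carrier_homeo_real by (simp add: carrier_PL_real_iff)
    thus "\<exists>U C. half_line g h U C \<and> half_line.\<sigma> h U \<in> carrier PL_real"
      using UC(1) by blast
  qed
  thus ?thesis
    using involution_imp_orientation_reversing[OF f] fG by (auto simp: orientation_reversing_iff)
qed

lemma strongly_reversible_PLF_real_iff:
  assumes f: "f \<in> carrier PLF_real"
  shows "strongly_reversible PLF_real f \<longleftrightarrow> reversible PLF_real f"
proof
  interpret homeo_group PLF_real by (rule homeo_group_PLF_real)
  show "strongly_reversible PLF_real f \<Longrightarrow> reversible PLF_real f"
    using f by (auto simp: strongly_reversible_iff' reversible_iff')
  assume "reversible PLF_real f"
  then obtain h where h: "h \<in> carrier PLF_real" "\<And>x. f (h (f x)) = h x"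
    using f by (auto simp: reversible_iff')
  have triv: "g x = x"
    if "g \<in> carrier PLF_real" "strict_mono g" "k \<in> carrier PLF_real" "strict_mono k"
      "\<And>x. g (k (g x)) = k x" for g k x
    using that by (intro increasing_conj_to_inverse_imp_id[of g k])
      (auto simp: carrier_PLF_real_iff carrier_homeo_real_iff)
  \<comment> \<open>When \<open>f\<close> is its own inverse, \<open>id\<close> is a reversing
    involution.\<close>
  have sr_id: "strongly_reversible PLF_real f" if "\<And>x. f (f x) = x"
    using f one_closed that by (auto simp: strongly_reversible_iff' one_id intro!: bexI[of _ id])
  from f show "strongly_reversible PLF_real f"
  proof (cases rule: carrier_cases)
    case fmono: 1
    from h(1) show ?thesis
    proof (cases rule: carrier_cases)
      case 1
      have "f x = x" for x
        by (rule triv[OF f fmono(1) h(1) 1(1) h(2)])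
      thus ?thesis using sr_id by simp
    next
      case 2
      show ?thesis
        using f fmono(1) h(1) 2(1) h(2)
      proof (rule strongly_reversible_if_half_line)
        fix g p q assume "based_reversal g h p q"
        then interpret based_reversal g h p q .
        have fin: "finite (non_affine_points k)" if "k \<in> {h, h', h \<circ> h}" for k
          using that h(1) inv_into_closed[OF h(1)] comp_closed[OF h(1) h(1)]
          by (auto simp: carrier_PLF_real_iff h'_def)
        interpret L: half_line g h "{p..}" "{p}"
          using fin by (intro half_line_if_finite) simp
        have "finite (non_affine_points L.\<sigma>)"
          using fin by (intro finite_subset[OF L.non_affine_points_\<sigma>]) simp_all
        hence "L.\<sigma> \<in> carrier PLF_real"
          using L.\<sigma>_carrier_homeo_real by (simp add: carrier_PLF_real_iff)
        thus "\<exists>U C. half_line g h U C \<and> half_line.\<sigma> h U \<in> carrier PLF_real"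
          using L.half_line_axioms by blast
      qed
    qed
  next
    case fanti: 2
    \<comment> \<open>\<open>f \<circ> h\<close> satisfies the same equation as \<open>h\<close> and
      has the opposite orientation, because \<open>f\<close> is decreasing.\<close>
    have "\<exists>k\<in>carrier PLF_real. strict_mono k \<and> (\<forall>x. f (k (f x)) = k x)"
      using h(1)
    proof (cases rule: carrier_cases)
      case 1
      thus ?thesis using h by blast
    next
      case 2
      have "strict_mono (f \<circ> h)"
        using fanti(1) 2(1) by (simp add: monotone_on_def)
      thus ?thesis using f h by (intro bexI[of _ "f \<circ> h"] comp_closed) auto
    qed
    then obtain k where k: "k \<in> carrier PLF_real" "strict_mono k" "\<And>x. f (k (f x)) = k x"
      by blast
    have "strict_mono (f \<circ> f)"
      using fanti(1) by (simp add: monotone_on_def)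
    \<comment> \<open>Applying the equation for \<open>k\<close> twice shows that \<open>k\<close>
      reverses \<open>f \<circ> f\<close>; both maps are increasing, so \<open>triv\<close>
      applies.\<close>
    hence "(f \<circ> f) x = x" for x
      using triv[OF comp_closed[OF f f] _ k(1,2)] k(3) by simp
    thus ?thesis using sr_id by simp
  qed
qed

theorem theorem1p2:
  shows "(\<forall>f \<in> orientation_preserving homeo_real. reversible homeo_real f \<longrightarrow>
           (strongly_reversible homeo_real f \<longleftrightarrow>
             (\<exists>h \<in> orientation_reversing homeo_real.
               h \<otimes>\<^bsub>homeo_real\<^esub> f \<otimes>\<^bsub>homeo_real\<^esub> inv\<^bsub>homeo_real\<^esub> h = inv\<^bsub>homeo_real\<^esub> f)))
       \<and> (\<forall>f \<in> carrier PLF_real. reversible PLF_real f \<longleftrightarrow> strongly_reversible PLF_real f)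
       \<and> (\<forall>f \<in> orientation_preserving PL_real. reversible PL_real f \<longrightarrow>
           (strongly_reversible PL_real f \<longleftrightarrow>
             (\<exists>h \<in> orientation_reversing PL_real.
               h \<otimes>\<^bsub>PL_real\<^esub> f \<otimes>\<^bsub>PL_real\<^esub> inv\<^bsub>PL_real\<^esub> h = inv\<^bsub>PL_real\<^esub> f)))"
  using strongly_reversible_homeo_real_iff strongly_reversible_PLF_real_iff
    strongly_reversible_PL_real_iff by blast

end
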